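(* Let $1\le n<q$ and let $\bm{v}_1,\dots,\bm{v}_q\in\mathbb{R}^n$ be the vertices of a convex polytope $P=\operatorname{conv}\{\bm{v}_1,\dots,\bm{v}_q\}$ with non-empty interior. Let $V\in\mathbb{R}^{n\times q}$ be the matrix whose $i$-th column is $\bm{v}_i$. Define $R:\mathbb{R}^n\to\mathbb{R}\cup\{+\infty\}$ by $$R(\bm{x})=\inf_{\bm{\lambda}\in\Delta^{q-1}}\Big\{\sum_{i=1}^q\lambda_i\ln\lambda_i \;\Big|\; V\bm{\lambda}=\bm{x}\Big\}.$$ Then $R$ is a superlinear function of Legendre type with $\operatorname{dom}(R)=P$. Its convex conjugate is given by $$R^*(\bm{y})=R_q^*(V^T\bm{y})\quad\text{for all }\bm{y}\in\mathbb{R}^n,$$ with gradient mapping $$\nabla R^*:\ \bm{y}\in\mathbb{R}^n\mapsto V\,\nabla R_q^*(V^T\bm{y})=V\operatorname{softmax}(V^T\bm{y})\in\operatorname{int}(P).$$ Finally, $\nabla R^*$ is a homeomorphism between $\mathbb{R}^n$ and $\operatorname{int}(P)$ with inverse $(\nabla R^* )^{-1}=\nabla R$.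
   Context: Notation: $\Delta^{q-1}=\{\bm{\lambda}\in\mathbb{R}^q:\sum_{i=1}^q\lambda_i=1,\ \lambda_i\ge 0\text{ for all }i\}$ is the standard simplex; $0\ln 0=0$; $\inf\emptyset=+\infty$; $|\cdot|$ is the Euclidean norm. The restricted Gibbs entropy $R_q:\mathbb{R}^q\to\mathbb{R}\cup\{+\infty\}$ is $R_q(\bm{\lambda})=\sum_{i=1}^q\lambda_i\ln\lambda_i$ for $\bm{\lambda}\in\Delta^{q-1}$ and $+\infty$ otherwise. The softmax function is $\operatorname{softmax}(\bm{z})_j=\exp(z_j)/\sum_{i=1}^q\exp(z_i)$ for $\bm{z}\in\mathbb{R}^q$. For a proper convex $f:\mathbb{R}^m\to\mathbb{R}\cup\{+\infty\}$: the effective domain is $\operatorname{dom}(f)=\{\bm{x}: f(\bm{x})<+\infty\}$; the subdifferential is $\partial f(\bm{x})=\{\bm{x}^*\in\mathbb{R}^m:\bm{x}^*\cdot(\bm{y}-\bm{x})+f(\bm{x})\le f(\bm{y})\ \forall\bm{y}\in\mathbb{R}^m\}$; $\operatorname{dom}(\partial f)=\{\bm{x}:\partial f(\bm{x})\ne\emptyset\}$; the convex conjugate is $f^*(\bm{y})=\sup_{\bm{x}\in\mathbb{R}^m}\{\bm{x}\cdot\bm{y}-f(\bm{x})\}$. A proper convex function $f$ is essentially strictly convex if it is strictly convex on every convex subset of $\operatorname{dom}(\partial f)$. It is essentially smooth if $\operatorname{int}\operatorname{dom}(f)\neq\emptyset$, $f$ is differentiable on $\operatorname{int}\operatorname{dom}(f)$,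 and $|\nabla f(\bm{x}_k)|\to+\infty$ whenever $(\bm{x}_k)\subset\operatorname{int}\operatorname{dom}(f)$ converges to a point of $\partial\operatorname{dom}(f)$. It is of Legendre type (a Legendre function) if it is both. It is superlinear if $f(\bm{x})/|\bm{x}|\to+\infty$ as $|\bm{x}|\to+\infty$. *)

theory Defs
  imports "HOL-Analysis.Analysis"
begin

text \<open>Functions with values in \<open>\<real> \<union> {+\<infinity>}\<close> are modelled as functions into \<^typ>\<open>ereal\<close> which,
  when proper, never take the value \<open>-\<infinity>\<close>.\<close>

definition eff_dom :: "('a \<Rightarrow> ereal) \<Rightarrow> 'a set" where
  "eff_dom f = {x. f x < \<infinity>}"

text \<open>In \<^typ>\<open>ereal\<close> one has \<open>0 * \<infinity> = 0\<close>, so the convexity inequality is trivial, as it should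
  be, at the end points of the unit interval.\<close>

definition proper_convex :: "('a::real_vector \<Rightarrow> ereal) \<Rightarrow> bool" where
  "proper_convex f \<longleftrightarrow>
     (\<forall>x. f x \<noteq> -\<infinity>) \<and> eff_dom f \<noteq> {} \<and>
     (\<forall>x y. \<forall>t\<in>{0..1}. f ((1 - t) *\<^sub>R x + t *\<^sub>R y) \<le> ereal (1 - t) * f x + ereal t * f y)"

definition subdifferential :: "('a::real_inner \<Rightarrow> ereal) \<Rightarrow> 'a \<Rightarrow> 'a set" where
  "subdifferential f x = {s. \<forall>y. ereal (s \<bullet> (y - x)) + f x \<le> f y}"

definition subdiff_dom :: "('a::real_inner \<Rightarrow> ereal) \<Rightarrow> 'a set" where
  "subdiff_dom f = {x. subdifferential f x \<noteq> {}}"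

definition conjugate :: "('a::real_inner \<Rightarrow> ereal) \<Rightarrow> 'a \<Rightarrow> ereal" where
  "conjugate f y = (SUP x. ereal (x \<bullet> y) - f x)"

text \<open>Differentiability at \<open>x\<close> requires finiteness in a neighbourhood of \<open>x\<close>; there the conversion
  \<^const>\<open>real_of_ereal\<close> (which maps infinite values to \<open>0\<close>) loses nothing.\<close>

definition has_gradient :: "('a::real_inner \<Rightarrow> ereal) \<Rightarrow> 'a \<Rightarrow> 'a \<Rightarrow> bool" where
  "has_gradient f x g \<longleftrightarrow>
     x \<in> interior {z. \<bar>f z\<bar> \<noteq> \<infinity>} \<and> GDERIV (\<lambda>z. real_of_ereal (f z)) x :> g"

definition has_some_gradient :: "('a::real_inner \<Rightarrow> ereal) \<Rightarrow> 'a \<Rightarrow> bool" where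
  "has_some_gradient f x \<longleftrightarrow> (\<exists>g. has_gradient f x g)"

definition grad :: "('a::real_inner \<Rightarrow> ereal) \<Rightarrow> 'a \<Rightarrow> 'a" where
  "grad f x = (THE g. has_gradient f x g)"

definition strictly_convex_on :: "'a::real_vector set \<Rightarrow> ('a \<Rightarrow> ereal) \<Rightarrow> bool" where
  "strictly_convex_on C f \<longleftrightarrow>
     (\<forall>x\<in>C. \<forall>y\<in>C. \<forall>t\<in>{0<..<1}. x \<noteq> y \<longrightarrow>
        f ((1 - t) *\<^sub>R x + t *\<^sub>R y) < ereal (1 - t) * f x + ereal t * f y)"

definition essentially_strictly_convex :: "('a::real_inner \<Rightarrow> ereal) \<Rightarrow> bool" where
  "essentially_strictly_convex f \<longleftrightarrow>
     (\<forall>C. convex C \<and> C \<subseteq> subdiff_dom f \<longrightarrow> strictly_convex_on C f)"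

definition essentially_smooth :: "('a::real_inner \<Rightarrow> ereal) \<Rightarrow> bool" where
  "essentially_smooth f \<longleftrightarrow>
     interior (eff_dom f) \<noteq> {} \<and>
     (\<forall>x\<in>interior (eff_dom f). has_some_gradient f x) \<and>
     (\<forall>X a. (\<forall>k. X k \<in> interior (eff_dom f)) \<and> X \<longlonglongrightarrow> a \<and> a \<in> frontier (eff_dom f) \<longrightarrow>
        filterlim (\<lambda>k. norm (grad f (X k))) at_top sequentially)"

definition legendre :: "('a::real_inner \<Rightarrow> ereal) \<Rightarrow> bool" where
  "legendre f \<longleftrightarrow> proper_convex f \<and> essentially_strictly_convex f \<and> essentially_smooth f"

definition superlinear :: "('a::real_normed_vector \<Rightarrow> ereal) \<Rightarrow> bool" where
  "superlinear f \<longleftrightarrow> ((\<lambda>x. f x / ereal (norm x)) \<longlongrightarrow> \<infinity>) at_infinity"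

definition prob_simplex :: "(real ^ 'q) set" where
  "prob_simplex = {l. (\<Sum>i\<in>UNIV. l $ i) = 1 \<and> (\<forall>i. 0 \<le> l $ i)}"

text \<open>The convention \<open>0 ln 0 = 0\<close> holds automatically since \<open>0 * c = 0\<close>.\<close>

definition gibbs_entropy :: "real ^ 'q \<Rightarrow> ereal" where
  "gibbs_entropy l =
     (if l \<in> prob_simplex then ereal (\<Sum>i\<in>UNIV. l $ i * ln (l $ i)) else \<infinity>)"

definition softmax :: "real ^ 'q \<Rightarrow> real ^ 'q" where
  "softmax z = (\<chi> j. exp (z $ j) / (\<Sum>i\<in>UNIV. exp (z $ i)))"

text \<open>The infimum is taken in \<^typ>\<open>ereal\<close>, so it is \<open>+\<infinity>\<close> if no \<open>l\<close> is feasible.\<close>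

definition polytope_entropy :: "real ^ 'q ^ 'n \<Rightarrow> real ^ 'n \<Rightarrow> ereal" where
  "polytope_entropy V x =
     (INF l\<in>{l \<in> prob_simplex. V *v l = x}. ereal (\<Sum>i\<in>UNIV. l $ i * ln (l $ i)))"

end

(* The Gibbs inequality l . z - log sum exp z <= sum l ln l on the simplex, with equality exactly at
   l = softmax z, applied to z = V^T y gives R x >= x . y - G y with G y = log sum exp (V^T y) and
   equality exactly when x = g y := V softmax (V^T y) = grad G y. Hence R* = G, and s is a
   subgradient of R at x iff x = g s, which yields strict convexity of R on the range of g. The map g
   is injective because P lies in no hyperplane, and it is onto int P by minimising y |-> G y - x . y,
   so by invariance of domain it is a homeomorphism; its inverse is a continuous selection of
   subgradients, that is, grad R. Gradients blow up at the boundary since g maps every ball onto a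
   compact subset of int P. *)

theory Submission
  imports Defs
begin

section \<open>Entropy and the convexity of x ln x\<close>

definition neg_entropy :: "real ^ 'q \<Rightarrow> real" where
  "neg_entropy l = (\<Sum>i\<in>UNIV. l $ i * ln (l $ i))"

definition log_sum_exp :: "real ^ 'q \<Rightarrow> real" where
  "log_sum_exp z = ln (\<Sum>i\<in>UNIV. exp (z $ i))"

text \<open>The left-hand side is the tangent at \<open>p\<close> of the convex function x ln x. For
  \<open>x > 0\<close> the bound is ln u \<le> u - 1 at u = p / x, multiplied by
  \<open>x\<close>.\<close>

lemma mult_ln_tangent:
  fixes x p :: real
  assumes "0 \<le> x" "0 < p"
  shows "x * ln p + x - p \<le> x * ln x"
proof (cases "x = 0")
  case False
  then have "ln (p / x) \<le> p / x - 1"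
    using assms by (intro ln_le_minus_one) simp
  then have "x * (ln p - ln x) \<le> x * (p / x - 1)"
    using assms False by (simp add: ln_div)
  then show ?thesis
    using False by (simp add: algebra_simps)
qed (use assms in simp)

text \<open>Equality in ln u \<le> u - 1 holds only at u = 1, and \<open>x = 0\<close> would force
  \<open>p = 0\<close>.\<close>

lemma mult_ln_tangent_eq:
  fixes x p :: real
  assumes "0 \<le> x" "0 < p" "x * ln p + x - p = x * ln x"
  shows "x = p"
proof (cases "x = 0")
  case False
  then have "x * (ln p - ln x) = x * (p / x - 1)"
    using assms(3) by (simp add: algebra_simps)
  then have "ln (p / x) = p / x - 1"
    using assms False by (simp add: ln_div)
  then have "p / x = 1"
    using assms False by (intro ln_eq_minus_one) auto
  then show ?thesis
    using False by simp
qed (use assms in simp)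

text \<open>Averaging the tangent bounds with base point \<open>m\<close> over \<open>a\<close> and
  \<open>b\<close> cancels the linear terms. The tangent requires \<open>m > 0\<close>; for
  \<open>m = 0\<close> both weighted points vanish.\<close>

lemma mult_ln_convex:
  fixes a b t :: real
  assumes "0 \<le> a" "0 \<le> b" "t \<in> {0..1}"
  defines "m \<equiv> (1 - t) * a + t * b"
  shows "m * ln m \<le> (1 - t) * (a * ln a) + t * (b * ln b)"
proof (cases "m = 0")
  case True
  then have "(1 - t) * a = 0" "t * b = 0"
    using assms add_nonneg_eq_0_iff[of "(1 - t) * a" "t * b"] by auto
  then show ?thesis
    using True by auto
next
  case False
  have "0 \<le> m"
    using assms by simp
  with False have "0 < m"
    by simp
  then have "(1 - t) * (a * ln m + a - m) + t * (b * ln m + b - m)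
      \<le> (1 - t) * (a * ln a) + t * (b * ln b)"
    using assms(1-3) by (intro add_mono mult_left_mono mult_ln_tangent) auto
  moreover have "(1 - t) * (a * ln m + a - m) + t * (b * ln m + b - m) = m * ln m"
    unfolding m_def by (simp add: algebra_simps)
  ultimately show ?thesis
    by simp
qed

text \<open>Only the point 0 is delicate: passing to the reciprocal reduces it to ln x / x tending
  to 0 at infinity.\<close>

lemma continuous_on_mult_ln: "continuous_on {0..} (\<lambda>x::real. x * ln x)"
proof -
  have "((\<lambda>x::real. x * ln x) \<longlongrightarrow> x * ln x) (at x within {0..})" if "0 \<le> x" for x :: real
  proof (cases "x = 0")
    case True
    have "((\<lambda>x::real. ln (inverse x) / inverse x) \<longlongrightarrow> 0) (at_right 0)"
      by (rule filterlim_compose[OF ln_x_over_x_tendsto_0 filterlim_inverse_at_top_right])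
    then have "((\<lambda>x::real. - (ln (inverse x) / inverse x)) \<longlongrightarrow> 0) (at_right 0)"
      using tendsto_minus by fastforce
    then have "((\<lambda>x::real. x * ln x) \<longlongrightarrow> 0) (at_right 0)"
      by (rule Lim_transform_eventually)
         (auto simp: eventually_at_right_field ln_inverse divide_inverse intro!: exI[of _ 1])
    then show ?thesis
      using True by (simp add: at_within_Ici_at_right)
  next
    case False
    then show ?thesis
      by (intro tendsto_intros)
  qed
  then show ?thesis
    by (auto simp: continuous_on_def)
qed

section \<open>Softmax and the Gibbs inequality\<close>

lemma sum_exp_pos: "0 < (\<Sum>i\<in>UNIV. exp (z $ i :: real))" for z :: "real ^ 'q::finite"
  by (intro sum_pos) auto

lemma softmax_pos: "0 < softmax z $ i"
  using sum_exp_pos[of z] by (simp add: softmax_def)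

lemma ln_softmax: "ln (softmax z $ i) = z $ i - log_sum_exp z"
  using sum_exp_pos[of z] by (simp add: softmax_def log_sum_exp_def ln_div)

lemma softmax_in_prob_simplex: "softmax z \<in> prob_simplex"
proof -
  have "(\<Sum>i\<in>UNIV. softmax z $ i) = 1"
    using sum_exp_pos[of z] by (simp add: softmax_def flip: sum_divide_distrib)
  then show ?thesis
    by (simp add: prob_simplex_def less_imp_le softmax_pos)
qed

text \<open>The summands are the tangents of \<open>mult_ln_tangent\<close> with base points
  \<open>softmax z $ i\<close>. Since \<open>l\<close> and \<open>softmax z\<close> both have total
  mass 1, the terms without logarithm cancel.\<close>

lemma gibbs_tangent_sum:
  assumes "l \<in> prob_simplex"
  shows "(\<Sum>i\<in>UNIV. l $ i * ln (softmax z $ i) + l $ i - softmax z $ i) = l \<bullet> z - log_sum_exp z"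
  using assms softmax_in_prob_simplex[of z]
  by (simp add: ln_softmax sum.distrib sum_subtractf right_diff_distrib prob_simplex_def
      inner_vec_def flip: sum_distrib_right)

lemma gibbs_inequality:
  assumes "l \<in> prob_simplex"
  shows "l \<bullet> z - log_sum_exp z \<le> neg_entropy l"
  unfolding gibbs_tangent_sum[OF assms, symmetric] neg_entropy_def
  using assms by (intro sum_mono mult_ln_tangent softmax_pos) (auto simp: prob_simplex_def)

text \<open>Termwise ordered sums agree only if all terms agree, and each tangent touches x ln x
  only at its base point.\<close>

lemma gibbs_equality:
  assumes "l \<in> prob_simplex"
  shows "neg_entropy l = l \<bullet> z - log_sum_exp z \<longleftrightarrow> l = softmax z"
proof
  assume "neg_entropy l = l \<bullet> z - log_sum_exp z"
  then have eq: "(\<Sum>i\<in>UNIV. l $ i * ln (softmax z $ i) + l $ i - softmax z $ i)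
      = (\<Sum>i\<in>UNIV. l $ i * ln (l $ i))"
    unfolding gibbs_tangent_sum[OF assms] neg_entropy_def by simp
  have nonneg: "0 \<le> l $ i" for i
    using assms by (simp add: prob_simplex_def)
  have "l $ i * ln (softmax z $ i) + l $ i - softmax z $ i = l $ i * ln (l $ i)" for i
    by (rule sum_mono_inv[OF eq]) (simp_all add: mult_ln_tangent nonneg softmax_pos)
  then have "l $ i = softmax z $ i" for i
    by (rule mult_ln_tangent_eq[OF nonneg softmax_pos])
  then show "l = softmax z"
    by (simp add: vec_eq_iff)
next
  assume l: "l = softmax z"
  show "neg_entropy l = l \<bullet> z - log_sum_exp z"
    unfolding gibbs_tangent_sum[OF assms, symmetric] neg_entropy_def by (simp add: l)
qed

section \<open>Entropy on the simplex\<close>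

lemma neg_entropy_nonpos:
  assumes "l \<in> prob_simplex"
  shows "neg_entropy l \<le> 0"
  unfolding neg_entropy_def
proof (intro sum_nonpos mult_nonneg_nonpos)
  fix i
  show nonneg: "0 \<le> l $ i"
    using assms by (simp add: prob_simplex_def)
  have "l $ i \<le> (\<Sum>i\<in>UNIV. l $ i)"
    using assms by (intro member_le_sum) (auto simp: prob_simplex_def)
  then have "l $ i \<le> 1"
    using assms by (simp add: prob_simplex_def)
  \<comment> \<open>A zero coordinate is covered by the default value
    \<open>ln 0 = 0\<close>.\<close>
  with nonneg show "ln (l $ i) \<le> 0"
    by (cases "l $ i = 0") auto
qed

lemma neg_entropy_convex:
  assumes "k \<in> prob_simplex" "l \<in> prob_simplex" "t \<in> {0..1}"
  shows "neg_entropy ((1 - t) *\<^sub>R k + t *\<^sub>R l) \<le> (1 - t) * neg_entropy k + t * neg_entropy l"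
  unfolding neg_entropy_def sum_distrib_left sum.distrib[symmetric]
  using assms by (intro sum_mono) (auto simp: prob_simplex_def intro!: mult_ln_convex)

lemma convex_prob_simplex: "convex (prob_simplex :: (real ^ 'q::finite) set)"
  by (auto simp: convex_def prob_simplex_def sum.distrib simp flip: sum_distrib_left)

lemma compact_prob_simplex: "compact (prob_simplex :: (real ^ 'q::finite) set)"
proof -
  have "prob_simplex \<subseteq> cbox 0 (1 :: real ^ 'q)"
  proof
    fix l :: "real ^ 'q" assume l: "l \<in> prob_simplex"
    have "l $ i \<le> (\<Sum>i\<in>UNIV. l $ i)" for i
      using l by (intro member_le_sum) (auto simp: prob_simplex_def)
    then show "l \<in> cbox 0 1"
      using l by (simp add: mem_box_cart prob_simplex_def)
  qed
  moreover have "closed (prob_simplex :: (real ^ 'q) set)"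
    unfolding prob_simplex_def
    by (intro closed_Collect_conj closed_Collect_all closed_Collect_eq closed_Collect_le
        continuous_intros)
  ultimately show ?thesis
    using bounded_cbox bounded_subset compact_eq_bounded_closed by blast
qed

lemma continuous_on_neg_entropy: "continuous_on prob_simplex neg_entropy"
  unfolding neg_entropy_def
  by (intro continuous_on_sum continuous_on_compose2[OF continuous_on_mult_ln] continuous_intros)
     (auto simp: prob_simplex_def)

section \<open>Gradients and the conjugate of the Gibbs entropy\<close>

lemma has_gradient_unique:
  assumes "has_gradient f x g" "has_gradient f x h"
  shows "g = h"
proof -
  have "(\<lambda>u. u \<bullet> g) = (\<lambda>u. u \<bullet> h)"
    using assms unfolding has_gradient_def gderiv_def by (blast intro: has_derivative_unique)
  then show ?thesis
    by (metis vector_eq_ldot)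
qed

lemma grad_eqI: "has_gradient f x g \<Longrightarrow> grad f x = g"
  unfolding grad_def by (blast intro: has_gradient_unique)

lemma has_gradient_ereal: "has_gradient (\<lambda>x. ereal (f x)) x g \<longleftrightarrow> GDERIV f x :> g"
  by (simp add: has_gradient_def)

lemma GDERIV_log_sum_exp: "GDERIV log_sum_exp z :> softmax z"
proof -
  have "(log_sum_exp has_derivative
      (\<lambda>h. (\<Sum>i\<in>UNIV. h $ i * exp (z $ i)) / (\<Sum>i\<in>UNIV. exp (z $ i)))) (at z)"
    unfolding log_sum_exp_def[abs_def] using sum_exp_pos[of z]
    by (auto intro!: derivative_eq_intros bounded_linear.has_derivative[OF bounded_linear_vec_nth]
        simp: divide_inverse mult.commute)
  then show ?thesis
    by (simp add: gderiv_def softmax_def inner_vec_def sum_divide_distrib)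
qed

text \<open>The Gibbs inequality bounds the supremum, and \<open>l = softmax z\<close> attains
  it.\<close>

lemma conjugate_gibbs_entropy: "conjugate gibbs_entropy z = ereal (log_sum_exp z)"
  unfolding conjugate_def
proof (rule SUP_eqI)
  fix l :: "real ^ 'a"
  show "ereal (l \<bullet> z) - gibbs_entropy l \<le> ereal (log_sum_exp z)"
    using gibbs_inequality[of l z]
    by (auto simp: gibbs_entropy_def simp flip: neg_entropy_def)
next
  fix u assume u: "\<And>l. l \<in> UNIV \<Longrightarrow> ereal (l \<bullet> z) - gibbs_entropy l \<le> u"
  have "ereal (softmax z \<bullet> z) - gibbs_entropy (softmax z) = ereal (log_sum_exp z)"
    using gibbs_equality[OF softmax_in_prob_simplex[of z], of z]
    by (simp add: gibbs_entropy_def softmax_in_prob_simplex flip: neg_entropy_def)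
  then show "ereal (log_sum_exp z) \<le> u"
    using u[of "softmax z"] by simp
qed

text \<open>Outside a large ball \<open>f\<close> is \<infinity>, hence so is the quotient.\<close>

lemma superlinear_if_bounded_eff_dom:
  fixes f :: "'a::real_normed_vector \<Rightarrow> ereal"
  assumes "bounded (eff_dom f)"
  shows "superlinear f"
proof -
  obtain B where B: "0 < B" "\<And>x. x \<in> eff_dom f \<Longrightarrow> norm x \<le> B"
    using assms bounded_pos by blast
  have "\<forall>\<^sub>F x in at_infinity. f x / ereal (norm x) = \<infinity>"
    unfolding eventually_at_infinity
  proof (intro exI allI impI)
    fix x :: 'a assume "B + 1 \<le> norm x"
    then have "x \<notin> eff_dom f" "0 < norm x"
      using B by fastforce+
    then show "f x / ereal (norm x) = \<infinity>"
      by (simp add: eff_dom_def)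
  qed
  then show ?thesis
    unfolding superlinear_def by (rule tendsto_eventually)
qed

section \<open>The polytope as a linear image of the simplex\<close>

declare transpose_matrix_vector [simp del]

text \<open>Carries the Gibbs inequality at V^T y over to the polytope. The simp rule removed above
  would rewrite \<open>transpose V *v y\<close> to \<open>y v* V\<close> and hide this
  pattern.\<close>

lemma transpose_inner: "l \<bullet> (transpose V *v y) = (V *v l) \<bullet> y"
  for V :: "real ^ 'q::finite ^ 'n::finite"
  by (metis dot_lmul_matrix inner_commute transpose_matrix_vector)

text \<open>The image of the simplex is convex and contains each column as the image of a unit
  vector; conversely \<open>V *v l\<close> is the convex combination of the columns with weights
  \<open>l\<close>.\<close>

lemma convex_hull_columns:
  fixes V :: "real ^ 'q::finite ^ 'n::finite"
  shows "convex hull (range (\<lambda>i. column i V)) = (\<lambda>l. V *v l) ` prob_simplex"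
proof
  have "axis i 1 \<in> (prob_simplex :: (real ^ 'q) set)" for i
    by (simp add: prob_simplex_def axis_def)
  then show "convex hull (range (\<lambda>i. column i V)) \<subseteq> (\<lambda>l. V *v l) ` prob_simplex"
    by (intro hull_minimal convex_linear_image convex_prob_simplex)
       (auto simp flip: matrix_vector_mult_basis)
  show "(\<lambda>l. V *v l) ` prob_simplex \<subseteq> convex hull (range (\<lambda>i. column i V))"
  proof
    fix x assume "x \<in> (\<lambda>l. V *v l) ` prob_simplex"
    then obtain l where l: "l \<in> prob_simplex" and x: "x = V *v l"
      by blast
    have "(\<Sum>i\<in>UNIV. l $ i *\<^sub>R column i V) \<in> convex hull (range (\<lambda>i. column i V))"
      using l by (intro convex_sum) (auto simp: prob_simplex_def hull_inc)
    then show "x \<in> convex hull (range (\<lambda>i. column i V))"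
      by (simp add: x matrix_mult_sum scalar_mult_eq_scaleR)
  qed
qed

text \<open>The fibre over \<open>x\<close> is a closed part of the compact simplex, on which the
  entropy is continuous. Having an actual minimiser is what lets equality cases pass from weights to
  points.\<close>

lemma polytope_entropy_attained:
  fixes V :: "real ^ 'q::finite ^ 'n::finite"
  assumes "x \<in> (\<lambda>l. V *v l) ` prob_simplex"
  obtains l where "l \<in> prob_simplex" "V *v l = x" "polytope_entropy V x = ereal (neg_entropy l)"
proof -
  let ?S = "{l \<in> prob_simplex. V *v l = x}"
  have "closed {l. V *v l = x}"
    by (intro closed_Collect_eq continuous_intros matrix_vector_mult_linear_continuous_on)
  then have "compact (prob_simplex \<inter> {l. V *v l = x})"
    using compact_prob_simplex by (rule compact_Int_closed[rotated])
  then have "compact ?S"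
    by (simp add: Collect_conj_eq)
  moreover have "?S \<noteq> {}"
    using assms by blast
  moreover have "continuous_on ?S neg_entropy"
    by (rule continuous_on_subset[OF continuous_on_neg_entropy]) blast
  ultimately have "\<exists>l\<in>?S. \<forall>k\<in>?S. neg_entropy l \<le> neg_entropy k"
    by (rule continuous_attains_inf)
  then obtain l where l: "l \<in> ?S" "\<And>k. k \<in> ?S \<Longrightarrow> neg_entropy l \<le> neg_entropy k"
    by blast
  have "polytope_entropy V x = ereal (neg_entropy l)"
    unfolding polytope_entropy_def neg_entropy_def[symmetric]
    using l by (intro antisym INF_lower INF_greatest) auto
  with l(1) that show thesis
    by blast
qed

lemma polytope_entropy_le:
  assumes "l \<in> prob_simplex"
  shows "polytope_entropy V (V *v l) \<le> ereal (neg_entropy l)"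
  unfolding polytope_entropy_def neg_entropy_def[symmetric] using assms by (intro INF_lower) auto

lemma polytope_entropy_outside:
  assumes "x \<notin> (\<lambda>l. V *v l) ` prob_simplex"
  shows "polytope_entropy V x = \<infinity>"
proof -
  have "{l \<in> prob_simplex. V *v l = x} = {}"
    using assms by blast
  then show ?thesis
    unfolding polytope_entropy_def by (simp only:) (simp add: top_ereal_def)
qed

lemma eff_dom_polytope_entropy:
  "eff_dom (polytope_entropy V) = (\<lambda>l. V *v l) ` prob_simplex"
proof (intro set_eqI)
  fix x
  show "x \<in> eff_dom (polytope_entropy V) \<longleftrightarrow> x \<in> (\<lambda>l. V *v l) ` prob_simplex"
  proof
    assume "x \<in> (\<lambda>l. V *v l) ` prob_simplex"
    then obtain l where "V *v l = x" "polytope_entropy V x = ereal (neg_entropy l)"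
      by (rule polytope_entropy_attained)
    then show "x \<in> eff_dom (polytope_entropy V)"
      by (simp add: eff_dom_def)
  qed (use polytope_entropy_outside in \<open>fastforce simp: eff_dom_def\<close>)
qed

section \<open>The Fenchel-Young inequality and its equality case\<close>

definition log_partition :: "real ^ 'q ^ 'n \<Rightarrow> real ^ 'n \<Rightarrow> real" where
  "log_partition V y = log_sum_exp (transpose V *v y)"

text \<open>\<open>log_partition V\<close> belongs to the exponential family with the columns of
  \<open>V\<close> as sufficient statistic; this is its mean parameter, the expectation of the
  columns under the Gibbs weights.\<close>

definition mean_map :: "real ^ 'q ^ 'n \<Rightarrow> real ^ 'n \<Rightarrow> real ^ 'n" where
  "mean_map V y = V *v softmax (transpose V *v y)"

text \<open>The Gibbs inequality for an optimal \<open>l\<close> and z = V^T y, where l . z = x .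
  y.\<close>

lemma fenchel_young: "ereal (x \<bullet> y - log_partition V y) \<le> polytope_entropy V x"
proof (cases "x \<in> (\<lambda>l. V *v l) ` prob_simplex")
  case True
  then obtain l where "l \<in> prob_simplex" "V *v l = x" "polytope_entropy V x = ereal (neg_entropy l)"
    by (rule polytope_entropy_attained)
  then show ?thesis
    using gibbs_inequality[of l "transpose V *v y"]
    by (auto simp: transpose_inner log_partition_def)
qed (simp add: polytope_entropy_outside)

text \<open>Equality forces equality in the Gibbs inequality for an optimal \<open>l\<close>, so
  \<open>l\<close> is the softmax vector. Conversely, the softmax weights are feasible for their
  mean and give the matching upper bound.\<close>

lemma fenchel_young_eq:
  "polytope_entropy V x = ereal (x \<bullet> y - log_partition V y) \<longleftrightarrow> x = mean_map V y"
proof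
  assume eq: "polytope_entropy V x = ereal (x \<bullet> y - log_partition V y)"
  then have "x \<in> (\<lambda>l. V *v l) ` prob_simplex"
    using polytope_entropy_outside by fastforce
  then obtain l where l: "l \<in> prob_simplex" "V *v l = x"
      "polytope_entropy V x = ereal (neg_entropy l)"
    by (rule polytope_entropy_attained)
  then have "neg_entropy l = l \<bullet> (transpose V *v y) - log_sum_exp (transpose V *v y)"
    using eq by (simp add: transpose_inner log_partition_def)
  then have "l = softmax (transpose V *v y)"
    using gibbs_equality l(1) by blast
  then show "x = mean_map V y"
    using l(2) by (simp add: mean_map_def)
next
  assume x: "x = mean_map V y"
  let ?l = "softmax (transpose V *v y)"
  have "neg_entropy ?l = x \<bullet> y - log_partition V y"
    using gibbs_equality[OF softmax_in_prob_simplex, of "transpose V *v y" "transpose V *v y"]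
    by (simp add: transpose_inner log_partition_def x mean_map_def)
  then have "polytope_entropy V x \<le> ereal (x \<bullet> y - log_partition V y)"
    using polytope_entropy_le[OF softmax_in_prob_simplex, of V "transpose V *v y"]
    by (simp add: x mean_map_def)
  then show "polytope_entropy V x = ereal (x \<bullet> y - log_partition V y)"
    using fenchel_young by (intro antisym)
qed

lemmas polytope_entropy_mean_map = fenchel_young_eq[THEN iffD2, OF refl]

section \<open>Convexity, subgradients and the conjugate\<close>

lemma proper_convex_polytope_entropy: "proper_convex (polytope_entropy V)"
  unfolding proper_convex_def
proof (intro conjI allI ballI)
  fix x show "polytope_entropy V x \<noteq> -\<infinity>"
    using fenchel_young[of x 0 V] by auto
next
  have "mean_map V 0 \<in> eff_dom (polytope_entropy V)"
    by (simp add: eff_dom_def polytope_entropy_mean_map)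
  then show "eff_dom (polytope_entropy V) \<noteq> {}"
    by blast
next
  fix x y and t :: real assume t: "t \<in> {0..1}"
  let ?R = "polytope_entropy V" and ?P = "(\<lambda>l. V *v l) ` prob_simplex"
  have not_minf: "?R z \<noteq> -\<infinity>" for z
    using fenchel_young[of z 0 V] by auto
  \<comment> \<open>The end points are separate because \<open>0 * \<infinity> = 0\<close> there;
    for \<open>0 < t < 1\<close> a single infinite value makes the right-hand side infinite.\<close>
  consider "t = 0" | "t = 1" | "0 < t" "t < 1" "x \<notin> ?P \<or> y \<notin> ?P" | "x \<in> ?P" "y \<in> ?P"
    using t by fastforce
  then show "?R ((1 - t) *\<^sub>R x + t *\<^sub>R y) \<le> ereal (1 - t) * ?R x + ereal t * ?R y"
  proof cases
    case 3
    then have "ereal (1 - t) * ?R x + ereal t * ?R y = \<infinity>"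
      using not_minf[of x] not_minf[of y]
      by (cases "?R x"; cases "?R y") (auto simp: polytope_entropy_outside)
    then show ?thesis
      by (simp only: ereal_less_eq(1))
  next
    case 4
    obtain k where k: "k \<in> prob_simplex" "V *v k = x" "?R x = ereal (neg_entropy k)"
      using 4 polytope_entropy_attained by blast
    obtain l where l: "l \<in> prob_simplex" "V *v l = y" "?R y = ereal (neg_entropy l)"
      using 4 polytope_entropy_attained by blast
    \<comment> \<open>Mixing the two minimisers gives a feasible competitor at the mixed
      point.\<close>
    let ?m = "(1 - t) *\<^sub>R k + t *\<^sub>R l"
    have "?m \<in> prob_simplex"
      using k l t by (intro convexD[OF convex_prob_simplex]) auto
    moreover have "V *v ?m = (1 - t) *\<^sub>R x + t *\<^sub>R y"
      using k l by (simp add: matrix_vector_right_distrib matrix_vector_mult_scaleR)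
    ultimately have "?R ((1 - t) *\<^sub>R x + t *\<^sub>R y) \<le> ereal (neg_entropy ?m)"
      by (metis polytope_entropy_le)
    also have "\<dots> \<le> ereal ((1 - t) * neg_entropy k + t * neg_entropy l)"
      using neg_entropy_convex k l t by simp
    finally show ?thesis
      by (simp add: k l)
  next
    case 1
    then show ?thesis
      by (simp only: diff_zero scaleR_one scaleR_zero_left add_0_right
          zero_ereal_def[symmetric] one_ereal_def[symmetric] mult_1 ereal_zero_mult add_0_right add_0 order_refl)
  next
    case 2
    then show ?thesis
      by (simp only: diff_self scaleR_one scaleR_zero_left add_0
          zero_ereal_def[symmetric] one_ereal_def[symmetric] mult_1 ereal_zero_mult add_0_right add_0 order_refl)
  qed
qed

text \<open>The subgradient inequality tested at \<open>mean_map V s\<close> is the reverse of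
  Fenchel-Young at \<open>x\<close>. Conversely, Fenchel-Young with equality at \<open>x\<close> is
  the subgradient inequality.\<close>

lemma subdifferential_polytope_entropy_iff:
  "s \<in> subdifferential (polytope_entropy V) x \<longleftrightarrow> x = mean_map V s"
proof
  assume s: "s \<in> subdifferential (polytope_entropy V) x"
  have "ereal (s \<bullet> (mean_map V s - x)) + polytope_entropy V x
      \<le> ereal (mean_map V s \<bullet> s - log_partition V s)"
    using s unfolding subdifferential_def polytope_entropy_mean_map[symmetric] by blast
  then have "polytope_entropy V x \<le> ereal (x \<bullet> s - log_partition V s)"
    by (cases "polytope_entropy V x") (auto simp: inner_diff_right inner_commute)
  then have "polytope_entropy V x = ereal (x \<bullet> s - log_partition V s)"
    using fenchel_young by (intro antisym)
  then show "x = mean_map V s"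
    by (simp add: fenchel_young_eq)
next
  assume x: "x = mean_map V s"
  show "s \<in> subdifferential (polytope_entropy V) x"
    unfolding subdifferential_def
  proof (intro CollectI allI)
    fix z
    have "ereal (s \<bullet> (z - x)) + polytope_entropy V x = ereal (z \<bullet> s - log_partition V s)"
      unfolding x polytope_entropy_mean_map by (simp add: inner_diff_right inner_commute)
    then show "ereal (s \<bullet> (z - x)) + polytope_entropy V x \<le> polytope_entropy V z"
      using fenchel_young by simp
  qed
qed

lemma subdiff_dom_polytope_entropy: "subdiff_dom (polytope_entropy V) = range (mean_map V)"
  unfolding subdiff_dom_def using subdifferential_polytope_entropy_iff by blast

text \<open>A subgradient \<open>s\<close> at the intermediate point \<open>z\<close> gives an
  affine minorant touching the entropy only at \<open>z\<close>. It lies strictly below at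
  \<open>x\<close> and \<open>y\<close>, and averaging keeps the strictness.\<close>

lemma essentially_strictly_convex_polytope_entropy:
  "essentially_strictly_convex (polytope_entropy V)"
  unfolding essentially_strictly_convex_def strictly_convex_on_def subdiff_dom_polytope_entropy
proof (intro allI impI ballI)
  fix C x y and t :: real
  assume C: "convex C \<and> C \<subseteq> range (mean_map V)" and xy: "x \<in> C" "y \<in> C" "x \<noteq> y"
    and t: "t \<in> {0<..<1}"
  define z where "z = (1 - t) *\<^sub>R x + t *\<^sub>R y"
  have "z \<in> C"
    unfolding z_def using C xy t by (intro convexD) auto
  then obtain s where s: "z = mean_map V s"
    using C by blast
  obtain a b where a: "polytope_entropy V x = ereal a" and b: "polytope_entropy V y = ereal b"
    using C xy polytope_entropy_mean_map by (metis imageE subsetD)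
  have "x \<noteq> z" "y \<noteq> z"
    using xy t by (auto simp: z_def algebra_simps simp flip: scaleR_diff_right)
  then have "x \<bullet> s - log_partition V s < a" "y \<bullet> s - log_partition V s < b"
    using fenchel_young[of x s V] fenchel_young_eq[of V x s]
      fenchel_young[of y s V] fenchel_young_eq[of V y s] a b s by auto
  then have "(1 - t) * (x \<bullet> s - log_partition V s) + t * (y \<bullet> s - log_partition V s)
      < (1 - t) * a + t * b"
    using t by (intro add_strict_mono mult_strict_left_mono) auto
  moreover have "z \<bullet> s - log_partition V s
      = (1 - t) * (x \<bullet> s - log_partition V s) + t * (y \<bullet> s - log_partition V s)"
    by (simp add: z_def inner_add_left algebra_simps)
  moreover have "polytope_entropy V z = ereal (z \<bullet> s - log_partition V s)"
    unfolding s by (rule polytope_entropy_mean_map)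
  ultimately show "polytope_entropy V ((1 - t) *\<^sub>R x + t *\<^sub>R y)
      < ereal (1 - t) * polytope_entropy V x + ereal t * polytope_entropy V y"
    by (simp add: a b flip: z_def)
qed

text \<open>Fenchel-Young bounds the supremum, and \<open>mean_map V y\<close> attains it.\<close>

lemma conjugate_polytope_entropy:
  "conjugate (polytope_entropy V) y = ereal (log_partition V y)"
  unfolding conjugate_def
proof (rule SUP_eqI)
  fix x
  show "ereal (x \<bullet> y) - polytope_entropy V x \<le> ereal (log_partition V y)"
    using fenchel_young[of x y V] by (cases "polytope_entropy V x") auto
next
  fix u assume "\<And>x. x \<in> UNIV \<Longrightarrow> ereal (x \<bullet> y) - polytope_entropy V x \<le> u"
  from this[of "mean_map V y"] show "ereal (log_partition V y) \<le> u"
    by (simp add: polytope_entropy_mean_map)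
qed

section \<open>Smoothness of the log-partition function\<close>

lemma GDERIV_log_partition: "GDERIV (log_partition V) y :> mean_map V y"
proof -
  have "((\<lambda>y. log_sum_exp (transpose V *v y)) has_derivative
      (\<lambda>h. (transpose V *v h) \<bullet> softmax (transpose V *v y))) (at y)"
    by (rule has_derivative_compose[OF
          bounded_linear_imp_has_derivative[OF matrix_vector_mul_bounded_linear]
          GDERIV_log_sum_exp[unfolded gderiv_def]])
  moreover have "(transpose V *v h) \<bullet> l = h \<bullet> (V *v l)" for h l
    by (metis inner_commute transpose_inner)
  ultimately show ?thesis
    by (simp add: gderiv_def log_partition_def[abs_def] mean_map_def)
qed

lemma continuous_on_mean_map: "continuous_on S (mean_map V)"
proof -
  have "continuous_on S (\<lambda>y. softmax (transpose V *v y))"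
    unfolding softmax_def
    by (intro continuous_on_vec_lambda continuous_intros matrix_vector_mult_linear_continuous_on)
       (use sum_exp_pos in \<open>metis less_irrefl\<close>)
  then show ?thesis
    unfolding mean_map_def[abs_def]
    by (rule continuous_on_compose2[OF matrix_vector_mult_linear_continuous_on[of UNIV]]) auto
qed

section \<open>The mean map as a homeomorphism onto the interior\<close>

locale solid_polytope =
  fixes V :: "real ^ 'q::finite ^ 'n::finite" and P :: "(real ^ 'n) set"
  assumes P_eq: "P = (\<lambda>l. V *v l) ` prob_simplex"
    and interior_nonempty: "interior P \<noteq> {}"
begin

text \<open>With equal means, the weights for \<open>y'\<close> also attain Gibbs equality for
  \<open>y\<close>, so both softmax vectors coincide. Then \<open>y - y'\<close> has constant inner
  product with all points of \<open>P\<close>.\<close>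

lemma inj_mean_map: "inj (mean_map V)"
proof (rule injI)
  fix y y' assume eq: "mean_map V y = mean_map V y'"
  let ?l = "softmax (transpose V *v y)" and ?l' = "softmax (transpose V *v y')"
  define c where "c = log_partition V y - log_partition V y'"
  have "neg_entropy ?l' = ?l' \<bullet> (transpose V *v y') - log_sum_exp (transpose V *v y')"
    using gibbs_equality[OF softmax_in_prob_simplex] by blast
  also have "\<dots> = mean_map V y \<bullet> y' - log_partition V y'"
    by (simp add: transpose_inner log_partition_def eq flip: mean_map_def)
  also have "\<dots> = mean_map V y \<bullet> y - log_partition V y"
    using polytope_entropy_mean_map[of V y] polytope_entropy_mean_map[of V y'] by (simp add: eq)
  also have "\<dots> = ?l' \<bullet> (transpose V *v y) - log_sum_exp (transpose V *v y)"
    by (simp add: transpose_inner log_partition_def eq flip: mean_map_def)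
  finally have "?l' = ?l"
    using gibbs_equality[OF softmax_in_prob_simplex] by blast
  \<comment> \<open>Taking logarithms of equal softmax vectors shows that their arguments differ by
    a constant vector.\<close>
  then have diff: "(transpose V *v (y - y')) $ i = c" for i
    using ln_softmax[of "transpose V *v y" i] ln_softmax[of "transpose V *v y'" i]
    by (simp add: c_def log_partition_def matrix_vector_mult_diff_distrib)
  have "(y - y') \<bullet> (V *v l) = c" if "l \<in> prob_simplex" for l
  proof -
    have "(y - y') \<bullet> (V *v l) = l \<bullet> (transpose V *v (y - y'))"
      by (simp add: transpose_inner inner_commute)
    also have "\<dots> = (\<Sum>i\<in>UNIV. l $ i) * c"
      by (simp add: inner_vec_def diff sum_distrib_right)
    finally show ?thesis
      using that by (simp add: prob_simplex_def)
  qed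
  then have "P \<subseteq> {x. (y - y') \<bullet> x = c}"
    by (auto simp: P_eq)
  \<comment> \<open>A hyperplane with nonzero normal has empty interior, so the normal must
    vanish.\<close>
  then have "interior {x. (y - y') \<bullet> x = c} \<noteq> {}"
    using interior_nonempty interior_mono by blast
  then show "y = y'"
    using interior_hyperplane[of "y - y'" c] by auto
qed

text \<open>Invariance of domain replaces the usual argument that a convex combination with positive
  weights lies in the relative interior.\<close>

lemma mean_map_in_interior: "mean_map V y \<in> interior P"
proof -
  have "open (range (mean_map V))"
    by (intro invariance_of_domain continuous_on_mean_map inj_mean_map open_UNIV)
  moreover have "range (mean_map V) \<subseteq> P"
    using softmax_in_prob_simplex by (auto simp: P_eq mean_map_def)
  ultimately show ?thesis
    using interior_maximal by blast
qed

lemma interior_subset_range_mean_map: "interior P \<subseteq> range (mean_map V)"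
proof
  \<comment> \<open>\<open>mean_map V y = x\<close> is the critical point equation of the coercive function \<open>phi\<close>.\<close>
  fix x assume "x \<in> interior P"
  then obtain r where r: "0 < r" "cball x r \<subseteq> P"
    using mem_interior_cball by blast
  define phi where "phi y = log_partition V y - y \<bullet> x" for y
  \<comment> \<open>The support function of \<open>P\<close> lies below
    \<open>log_partition V\<close>: the entropy term in the Gibbs inequality is nonpositive.\<close>
  have ge: "p \<bullet> y \<le> log_partition V y" if p: "p \<in> P" for p y
  proof -
    obtain l where l: "l \<in> prob_simplex" "p = V *v l"
      using p by (auto simp: P_eq)
    show ?thesis
      using gibbs_inequality[OF l(1), of "transpose V *v y"] neg_entropy_nonpos[OF l(1)]
      by (simp add: l(2) transpose_inner log_partition_def)
  qed
  \<comment> \<open>Apply \<open>ge\<close> to the point of \<open>P\<close> reached from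
    \<open>x\<close> by a step of length \<open>r\<close> in direction \<open>y\<close>; for
    \<open>y = 0\<close> this is \<open>x\<close> itself, as \<open>sgn 0 = 0\<close>.\<close>
  have coercive: "r * norm y \<le> phi y" for y
  proof -
    have "x + r *\<^sub>R sgn y \<in> P"
      using r by (intro subsetD[OF r(2)]) (simp add: dist_norm norm_sgn)
    then have "(x + r *\<^sub>R sgn y) \<bullet> y \<le> log_partition V y"
      by (rule ge)
    moreover have "sgn y \<bullet> y = norm y"
      by (cases "y = 0") (simp_all add: sgn_div_norm dot_square_norm power2_eq_square)
    ultimately show ?thesis
      by (simp add: phi_def inner_add_left inner_commute[of y x])
  qed
  have cont: "continuous_on S phi" for S
  proof -
    have "continuous_on S (log_partition V)"
      by (rule has_derivative_continuous_on)
         (rule has_derivative_at_withinI[OF GDERIV_log_partition[unfolded gderiv_def]])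
    then show ?thesis
      unfolding phi_def by (intro continuous_intros)
  qed
  \<comment> \<open>Beyond the radius \<open>phi 0 / r\<close> coercivity gives values of at least
    \<open>phi 0\<close>, so a minimum over this ball is global.\<close>
  have "0 \<le> phi 0 / r"
    using coercive[of 0] r(1) by simp
  then have "\<exists>y\<in>cball 0 (phi 0 / r). \<forall>u\<in>cball 0 (phi 0 / r). phi y \<le> phi u"
    by (intro continuous_attains_inf cont) auto
  then obtain y where min: "\<And>u. u \<in> cball 0 (phi 0 / r) \<Longrightarrow> phi y \<le> phi u"
    by blast
  have "phi y \<le> phi u" for u
  proof (cases "u \<in> cball 0 (phi 0 / r)")
    case False
    then have "phi 0 \<le> r * norm u"
      using r(1) by (simp add: field_simps)
    moreover have "phi y \<le> phi 0"
      using \<open>0 \<le> phi 0 / r\<close> by (intro min) simp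
    ultimately show ?thesis
      using coercive[of u] by simp
  qed (rule min)
  moreover have "(phi has_derivative (\<lambda>h. h \<bullet> mean_map V y - h \<bullet> x)) (at y)"
    unfolding phi_def using GDERIV_log_partition[of V y, unfolded gderiv_def]
    by (auto intro!: derivative_eq_intros)
  ultimately have "(\<lambda>h. h \<bullet> mean_map V y - h \<bullet> x) = (\<lambda>h. 0)"
    by (intro differential_zero_maxmin[of y UNIV phi]) auto
  \<comment> \<open>The vanishing derivative is evaluated at
    \<open>h = mean_map V y - x\<close>.\<close>
  then have "(mean_map V y - x) \<bullet> (mean_map V y - x) = 0"
    by (metis inner_diff_right)
  then show "x \<in> range (mean_map V)"
    by auto
qed

lemma range_mean_map: "range (mean_map V) = interior P"
  using interior_subset_range_mean_map mean_map_in_interior by blast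

text \<open>Continuity of the inverse comes from invariance of domain: an injective continuous map
  on an open set of the same dimension is open.\<close>

lemma homeomorphism_mean_map: "homeomorphism UNIV (interior P) (mean_map V) (inv (mean_map V))"
proof -
  have "continuous_on (range (mean_map V)) (inv (mean_map V))"
    using inj_mean_map by (intro continuous_on_inverse_open continuous_on_mean_map) auto
  then show ?thesis
    using inj_mean_map
    by (simp add: homeomorphism_def continuous_on_mean_map inj_imp_surj_inv surj_f_inv_f
        f_inv_into_f flip: range_mean_map)
qed

section \<open>Differentiability and boundary behaviour of the polytope entropy\<close>

lemma has_gradient_polytope_entropy:
  assumes "x \<in> interior P"
  shows "has_gradient (polytope_entropy V) x (inv (mean_map V) x)"
proof -
  let ?R = "\<lambda>z. real_of_ereal (polytope_entropy V z)" and ?h = "inv (mean_map V)"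
  have h: "mean_map V (?h z) = z" if "z \<in> interior P" for z
    using that homeomorphism_mean_map by (simp add: homeomorphism_apply2)
  \<comment> \<open>The Fenchel-Young equality case, with \<open>?h z\<close> as the dual point of
    \<open>z\<close>.\<close>
  have R: "polytope_entropy V z = ereal (z \<bullet> ?h z - log_partition V (?h z))" if "z \<in> interior P" for z
    using polytope_entropy_mean_map[of V "?h z"] by (simp add: h that)
  have finite: "interior P \<subseteq> interior {z. \<bar>polytope_entropy V z\<bar> \<noteq> \<infinity>}"
    using R by (intro interior_maximal) auto
  \<comment> \<open>Applied at both \<open>x\<close> and \<open>z\<close>, this bounds the first-order remainder at \<open>x\<close>
    by \<open>(z - x) \<bullet> (?h z - ?h x)\<close>, so continuity of \<open>?h\<close> gives differentiability.\<close>
  have subgrad: "(w - z) \<bullet> ?h z \<le> ?R w - ?R z" if "z \<in> interior P" "w \<in> interior P" for z w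
    using fenchel_young[of w "?h z" V] by (simp add: R that inner_diff_left)
  have "((\<lambda>z. norm (?h z - ?h x)) \<longlongrightarrow> 0) (at x)"
  proof -
    have "continuous_on (interior P) ?h"
      using homeomorphism_mean_map by (simp add: homeomorphism_def)
    then have "(?h \<longlongrightarrow> ?h x) (at x)"
      using assms by (simp add: continuous_on_eq_continuous_at isCont_def)
    then show ?thesis
      by (simp add: LIM_zero tendsto_norm_zero)
  qed
  moreover have "\<forall>\<^sub>F z in at x. norm ((?R z - ?R x - (z - x) \<bullet> ?h x) /\<^sub>R norm (z - x))
      \<le> norm (?h z - ?h x)"
  proof -
    have "\<forall>\<^sub>F z in at x. z \<in> interior P \<and> z \<noteq> x"
      using assms eventually_at_in_open[OF open_interior] by fastforce
    then show ?thesis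
    proof eventually_elim
      case (elim z)
      have "0 \<le> ?R z - ?R x - (z - x) \<bullet> ?h x"
        using subgrad assms elim by simp
      moreover have "?R z - ?R x - (z - x) \<bullet> ?h x \<le> (z - x) \<bullet> (?h z - ?h x)"
        using subgrad[of z x] assms elim by (simp add: inner_diff_left inner_diff_right)
      moreover have "(z - x) \<bullet> (?h z - ?h x) \<le> norm (z - x) * norm (?h z - ?h x)"
        by (rule norm_cauchy_schwarz)
      ultimately show ?case
        using elim by (simp add: field_simps)
    qed
  qed
  ultimately have "((\<lambda>z. (?R z - ?R x - (z - x) \<bullet> ?h x) /\<^sub>R norm (z - x)) \<longlongrightarrow> 0) (at x)"
    by (rule Lim_null_comparison[rotated])
  then have "GDERIV ?R x :> ?h x"
    by (simp add: gderiv_def has_derivative_within bounded_linear_inner_left divide_inverse_commute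
        diff_diff_eq)
  then show ?thesis
    using assms finite by (auto simp: has_gradient_def)
qed

lemma grad_polytope_entropy:
  "x \<in> interior P \<Longrightarrow> grad (polytope_entropy V) x = inv (mean_map V) x"
  by (intro grad_eqI has_gradient_polytope_entropy)

text \<open>The compact image of a ball of radius \<open>M\<close> lies in the interior of
  \<open>P\<close>, so its complement is a neighbourhood of the frontier point \<open>a\<close>.
  Once \<open>X k\<close> is in it, the gradient at \<open>X k\<close>, being its preimage under
  \<open>mean_map V\<close>, lies outside the ball.\<close>

lemma essentially_smooth_polytope_entropy: "essentially_smooth (polytope_entropy V)"
  unfolding essentially_smooth_def eff_dom_polytope_entropy P_eq[symmetric]
proof (intro conjI allI impI ballI)
  show "interior P \<noteq> {}"
    by (rule interior_nonempty)
  show "has_some_gradient (polytope_entropy V) x" if "x \<in> interior P" for x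
    unfolding has_some_gradient_def using has_gradient_polytope_entropy[OF that] by blast
  fix X a
  assume X: "(\<forall>k. X k \<in> interior P) \<and> X \<longlonglongrightarrow> a \<and> a \<in> frontier P"
  have gradX: "mean_map V (grad (polytope_entropy V) (X k)) = X k" for k
    using X homeomorphism_mean_map by (simp add: grad_polytope_entropy homeomorphism_apply2)
  show "filterlim (\<lambda>k. norm (grad (polytope_entropy V) (X k))) at_top sequentially"
    unfolding filterlim_at_top
  proof
    fix M
    have "compact (mean_map V ` cball 0 M)"
      by (intro compact_continuous_image continuous_on_mean_map compact_cball)
    then have "open (- mean_map V ` cball 0 M)"
      by (simp add: compact_imp_closed open_Compl)
    moreover have "a \<notin> mean_map V ` cball 0 M"
      using X mean_map_in_interior by (auto simp: frontier_def)
    ultimately have "\<forall>\<^sub>F k in sequentially. X k \<in> - mean_map V ` cball 0 M"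
      using X topological_tendstoD by (metis ComplI)
    then show "\<forall>\<^sub>F k in sequentially. M \<le> norm (grad (polytope_entropy V) (X k))"
    proof eventually_elim
      case (elim k)
      then have "grad (polytope_entropy V) (X k) \<notin> cball 0 M"
        using gradX by (metis ComplD image_eqI)
      then show ?case
        by simp
    qed
  qed
qed

lemma legendre_polytope_entropy: "legendre (polytope_entropy V)"
  unfolding legendre_def
  by (intro conjI proper_convex_polytope_entropy essentially_strictly_convex_polytope_entropy
      essentially_smooth_polytope_entropy)

end

section \<open>Duality between the polytope entropy and its conjugate\<close>

theorem theorem3p6:
  fixes v :: "'q::finite \<Rightarrow> real ^ 'n::finite"
    and V :: "real ^ 'q ^ 'n"
    and P :: "(real ^ 'n) set"
    and R :: "real ^ 'n \<Rightarrow> ereal"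
  assumes "CARD('n) < CARD('q)"
    and "P = convex hull (range v)"
    and "bij_betw v UNIV {x. x extreme_point_of P}"
    and "interior P \<noteq> {}"
    and "\<And>i. column i V = v i"
    and "R = polytope_entropy V"
  shows "superlinear R \<and> legendre R \<and> eff_dom R = P
    \<and> (\<forall>y. conjugate R y = conjugate gibbs_entropy (transpose V *v y))
    \<and> (\<forall>y. has_some_gradient (conjugate R) y
          \<and> has_some_gradient (conjugate gibbs_entropy) (transpose V *v y)
          \<and> grad (conjugate R) y = V *v grad (conjugate gibbs_entropy) (transpose V *v y)
          \<and> V *v grad (conjugate gibbs_entropy) (transpose V *v y)
              = V *v softmax (transpose V *v y)
          \<and> V *v softmax (transpose V *v y) \<in> interior P)
    \<and> homeomorphism UNIV (interior P) (grad (conjugate R)) (grad R)"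
proof -
  have P_eq: "P = (\<lambda>l. V *v l) ` prob_simplex"
    using assms(2) convex_hull_columns[of V] by (simp add: assms(5))
  interpret solid_polytope V P
    using P_eq assms(4) by unfold_locales
  have conj: "conjugate R = (\<lambda>y. ereal (log_partition V y))"
    by (simp add: assms(6) conjugate_polytope_entropy fun_eq_iff)
  have conj_gibbs: "conjugate gibbs_entropy = (\<lambda>z :: real ^ 'q. ereal (log_sum_exp z))"
    by (simp add: conjugate_gibbs_entropy fun_eq_iff)
  have grad_conj: "has_gradient (conjugate R) y (mean_map V y)" for y
    unfolding conj has_gradient_ereal by (rule GDERIV_log_partition)
  have grad_gibbs: "has_gradient (conjugate gibbs_entropy) z (softmax z)" for z :: "real ^ 'q"
    unfolding conj_gibbs has_gradient_ereal by (rule GDERIV_log_sum_exp)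
  have dom: "eff_dom R = P"
    by (simp add: assms(6) eff_dom_polytope_entropy P_eq)
  have "bounded P"
    unfolding P_eq by (intro compact_imp_bounded compact_continuous_image
        matrix_vector_mult_linear_continuous_on compact_prob_simplex)
  then have superlin: "superlinear R"
    by (intro superlinear_if_bounded_eff_dom) (simp add: dom)
  have grad_R: "grad R x = inv (mean_map V) x" if "x \<in> interior P" for x
    unfolding assms(6) by (rule grad_polytope_entropy[OF that])
  \<comment> \<open>The gradients agree with \<open>mean_map V\<close> everywhere and with its
    inverse on the interior of \<open>P\<close>, so the homeomorphism transfers.\<close>
  have homeo: "homeomorphism UNIV (interior P) (grad (conjugate R)) (grad R)"
    using homeomorphism_mean_map
    by (rule homeomorphism_cong)
       (simp_all add: grad_eqI[OF grad_conj] grad_R)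
  show ?thesis
  proof (intro conjI allI)
    show "legendre R"
      unfolding assms(6) by (rule legendre_polytope_entropy)
    fix y
    show "conjugate R y = conjugate gibbs_entropy (transpose V *v y)"
      by (simp add: conj conj_gibbs log_partition_def)
    show "has_some_gradient (conjugate R) y"
      and "has_some_gradient (conjugate gibbs_entropy) (transpose V *v y)"
      using grad_conj grad_gibbs by (auto simp: has_some_gradient_def)
    show "grad (conjugate R) y = V *v grad (conjugate gibbs_entropy) (transpose V *v y)"
      by (simp add: grad_eqI[OF grad_conj] grad_eqI[OF grad_gibbs] mean_map_def)
    show "V *v grad (conjugate gibbs_entropy) (transpose V *v y) = V *v softmax (transpose V *v y)"
      by (simp add: grad_eqI[OF grad_gibbs])
    show "V *v softmax (transpose V *v y) \<in> interior P"
      using mean_map_in_interior by (simp add: mean_map_def)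
  qed (fact superlin dom homeo)+
qed

end
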